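(* Let $\mathbb{F}_q$ be a finite field with $q$ elements and let $L$ be the four-dimensional abelian Lie algebra over $\mathbb{F}_q$. Let $\mathcal{L}$, $\mathcal{P}_2$, $\mathcal{P}_3$ be the sets of one-, two- and three-dimensional Lie subalgebras of $L$, respectively. Then the comaximal graph $\Gamma(L)$ has vertex set $\mathcal{L}\sqcup\mathcal{P}_2\sqcup\mathcal{P}_3$, and adjacency $\sim$ is described as follows: (1) If $A,B\in\mathcal{P}_3$ with $A\neq B$, then $A\sim B$; thus the induced subgraph on $\mathcal{P}_3$ is the complete graph $K_{q^3+q^2+q+1}$. (2) If $A,B\in\mathcal{P}_2$, then $A\sim B$ if and only if $A\cap B=0$. (3) If $A,B\in\mathcal{L}$, then $A$ and $B$ are never adjacent; thus $\mathcal{L}$ is an independent set. (4) If $A\in\mathcal{L}$ and $B\in\mathcal{P}_2$, then $A$ and $B$ are never adjacent. (5) If $A\in\mathcal{L}$ and $B\in\mathcal{P}_3$, then $A\sim B$ if and only if $A\cap B=0$.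
   Context: For a finite-dimensional Lie algebra $L$, the comaximal graph $\Gamma(L)$ is the simple undirected graph whose vertices are the proper nonzero Lie subalgebras of $L$; two distinct vertices $A,B$ are adjacent (written $A\sim B$) if and only if the Lie subalgebra $\langle A,B\rangle$ generated by $A\cup B$ equals $L$. *)

theory Defs
  imports "HOL.Vector_Spaces" "Graph_Theory.Graph_Theory"
begin

text \<open>
  The underlying space of a Lie algebra is a whole type, as for the locale
  \<^locale>\<open>vector_space\<close>; thus the Lie algebra itself is \<^term>\<open>UNIV\<close>.
\<close>

locale lie_algebra = vector_space scale
  for scale :: "'k::field \<Rightarrow> 'v::ab_group_add \<Rightarrow> 'v" (infixr \<open>*s\<close> 75) +
  fixes bracket :: "'v \<Rightarrow> 'v \<Rightarrow> 'v"
  assumes linear_bracket_left: "Vector_Spaces.linear scale scale (\<lambda>x. bracket x y)"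
    and linear_bracket_right: "Vector_Spaces.linear scale scale (\<lambda>y. bracket x y)"
    and bracket_self: "bracket x x = 0"
    and jacobi: "bracket x (bracket y z) + bracket y (bracket z x) + bracket z (bracket x y) = 0"
begin

definition lie_subalgebra :: "'v set \<Rightarrow> bool" where
  "lie_subalgebra A \<longleftrightarrow> subspace A \<and> (\<forall>x\<in>A. \<forall>y\<in>A. bracket x y \<in> A)"

definition lie_subalgebras_of_dim :: "nat \<Rightarrow> 'v set set" where
  "lie_subalgebras_of_dim n = {A. lie_subalgebra A \<and> dim A = n}"

definition lie_generated :: "'v set \<Rightarrow> 'v set" where
  "lie_generated S = lie_subalgebra hull S"

text \<open>
  As usual in \<^theory>\<open>Graph_Theory.Digraph\<close>, an undirected simple graph is
  a symmetric loop-free digraph whose arcs are pairs of vertices.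
\<close>

definition comaximal_graph :: "('v set, 'v set \<times> 'v set) pre_digraph" where
  "comaximal_graph =
    (let V = {A. lie_subalgebra A \<and> A \<noteq> {0} \<and> A \<noteq> UNIV}
     in with_proj \<lparr>pverts = V,
          parcs = {(A, B). A \<in> V \<and> B \<in> V \<and> A \<noteq> B \<and> lie_generated (A \<union> B) = UNIV}\<rparr>)"

definition abelian :: bool where
  "abelian \<longleftrightarrow> (\<forall>x y. bracket x y = 0)"

lemma lie_subalgebra_lie_generated: "lie_subalgebra (lie_generated S)"
  unfolding lie_generated_def
proof (rule hull_in)
  fix T assume T: "Ball T lie_subalgebra"
  then have "subspace (\<Inter>T)"
    by (intro subspace_Inter) (auto simp: lie_subalgebra_def)
  with T show "lie_subalgebra (\<Inter>T)"
    by (auto simp: lie_subalgebra_def)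
qed

lemma sym_digraph_comaximal_graph: "sym_digraph comaximal_graph"
  by unfold_locales
    (auto simp: comaximal_graph_def Let_def symmetric_def sym_def Un_commute)

lemma loopfree_digraph_comaximal_graph: "loopfree_digraph comaximal_graph"
  by unfold_locales (auto simp: comaximal_graph_def Let_def)

lemma nomulti_digraph_comaximal_graph: "nomulti_digraph comaximal_graph"
  by unfold_locales (auto simp: comaximal_graph_def Let_def arc_to_ends_def)

end

definition independent_vertices :: "('a, 'b) pre_digraph \<Rightarrow> 'a set \<Rightarrow> bool" where
  "independent_vertices G S \<longleftrightarrow> S \<subseteq> verts G \<and> (\<forall>u\<in>S. \<forall>v\<in>S. \<not> u \<rightarrow>\<^bsub>G\<^esub> v)"

end

theory Submission
  imports Defs
begin

text \<open>
  In an abelian Lie algebra the subalgebras are the subspaces and generation is linear span, so by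
  the dimension formula A and B generate the whole space iff
  dim A + dim B = n + dim (A \<inter> B). For the number of hyperplanes, every nonzero linear
  functional has a hyperplane as kernel, and the functionals with a given kernel are the nonzero
  multiples of one of them: of the q^n - 1 nonzero functionals, exactly q - 1 belong to each
  hyperplane.
\<close>

section \<open>Linear functionals, hyperplanes and spanning pairs of subspaces\<close>

context finite_dimensional_vector_space
begin

definition functionals :: "('b \<Rightarrow> 'a) set" where
  "functionals = {f. Vector_Spaces.linear scale (*) f}"

text \<open>With \<open>Suc\<close> the zero-dimensional space has no hyperplanes; truncated
  subtraction in \<open>dim H = dimension - 1\<close> would admit the whole space there.\<close>

definition hyperplanes :: "'b set set" where
  "hyperplanes = {H. subspace H \<and> Suc (dim H) = dimension}"

lemma vector_space_pair_functionals: "vector_space_pair scale ((*) :: 'a \<Rightarrow> 'a \<Rightarrow> 'a)"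
  by unfold_locales (auto simp: algebra_simps)

lemma functional_eqI:
  assumes "f \<in> functionals" "g \<in> functionals" "span B = UNIV"
    and "\<And>b. b \<in> B \<Longrightarrow> f b = g b"
  shows "f = g"
proof
  interpret P: vector_space_pair scale "(*)"
    by (rule vector_space_pair_functionals)
  show "f x = g x" for x
    using assms P.linear_eq_on[of f g x B] by (simp add: functionals_def)
qed

lemma functional_on_basis:
  assumes "independent B"
  obtains f where "f \<in> functionals" "\<And>b. b \<in> B \<Longrightarrow> f b = g b"
proof -
  interpret P: vector_space_pair scale "(*)"
    by (rule vector_space_pair_functionals)
  show ?thesis
    using that P.linear_construct[OF assms] P.construct_basis[OF assms]
    by (auto simp: functionals_def)
qed

text \<open>The values on a basis can be prescribed freely and determine the functional. Restricting
  makes the value function extensional, so that the target is a finite product with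
  q^\<open>dimension\<close> elements over a field of q elements.\<close>

lemma bij_betw_functionals:
  "bij_betw (\<lambda>f. restrict f Basis) functionals (Basis \<rightarrow>\<^sub>E UNIV)"
proof (rule bij_betw_imageI)
  show "inj_on (\<lambda>f. restrict f Basis) functionals"
    by (rule inj_onI) (metis functional_eqI restrict_apply' span_Basis)
  have "g \<in> (\<lambda>f. restrict f Basis) ` functionals" if g: "g \<in> Basis \<rightarrow>\<^sub>E UNIV" for g
  proof -
    obtain f where f: "f \<in> functionals" "\<And>b. b \<in> Basis \<Longrightarrow> f b = g b"
      using functional_on_basis[OF independent_Basis] by blast
    moreover have "restrict f Basis = g"
      using g f(2) by (auto simp: restrict_def fun_eq_iff PiE_iff extensional_def)
    ultimately show ?thesis
      by blast
  qed
  then show "(\<lambda>f. restrict f Basis) ` functionals = (Basis \<rightarrow>\<^sub>E UNIV)"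
    by auto
qed

lemma
  assumes "finite (UNIV :: 'a set)"
  shows finite_functionals: "finite functionals"
    and card_functionals: "card functionals = card (UNIV :: 'a set) ^ dimension"
proof -
  have "finite (Basis \<rightarrow>\<^sub>E (UNIV :: 'a set))"
    using assms finite_Basis by (intro finite_PiE) auto
  then show "finite functionals"
    using bij_betw_finite[OF bij_betw_functionals] by simp
  show "card functionals = card (UNIV :: 'a set) ^ dimension"
    using bij_betw_same_card[OF bij_betw_functionals] finite_Basis
    by (simp add: card_PiE dimension_def)
qed

lemma zero_in_functionals: "(\<lambda>_. 0) \<in> functionals"
  using vector_space_pair.linear_zero[OF vector_space_pair_functionals]
  by (simp add: functionals_def)

text \<open>Only one dimension is missing, and any vector outside \<open>H\<close> supplies
  it.\<close>

lemma span_insert_hyperplane: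
  assumes "H \<in> hyperplanes" "v \<notin> H"
  shows "span (insert v H) = UNIV"
proof -
  have "v \<notin> span H"
    using assms by (auto simp: hyperplanes_def span_eq_iff[THEN iffD2])
  then have "dim (insert v H) = dimension"
    using assms by (simp add: hyperplanes_def dim_insert)
  then show ?thesis
    by (simp add: dim_eq_full)
qed

lemma kernel_in_hyperplanes:
  assumes f: "f \<in> functionals" and "f \<noteq> (\<lambda>_. 0)"
  shows "{x. f x = 0} \<in> hyperplanes"
proof -
  interpret Vector_Spaces.linear scale "(*)" f
    using f by (simp add: functionals_def)
  let ?K = "{x. f x = 0}"
  obtain v where v: "f v \<noteq> 0"
    using assms(2) by auto
  have K: "subspace ?K"
    by (rule subspace_kernel)
  then have span_K: "span ?K = ?K"
    by (simp add: span_eq_iff)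
  have "x \<in> span (insert v ?K)" for x
  proof -
    \<comment> \<open>The multiple of \<open>v\<close> is chosen to have the same value under
      \<open>f\<close> as \<open>x\<close>. Hence the kernel together with \<open>v\<close> spans
      everything, and the kernel has codimension one.\<close>
    have "x - (f x / f v) *s v \<in> ?K"
      using v by (simp add: diff scale)
    then show ?thesis
      unfolding span_breakdown_eq span_K by blast
  qed
  then have "dim (insert v ?K) = dimension"
    by (auto simp: dim_eq_full)
  then show ?thesis
    using v K by (simp add: hyperplanes_def dim_insert span_K)
qed

text \<open>Since \<open>H\<close> and \<open>v\<close> span the space, a functional vanishing on
  \<open>H\<close> is determined by its value at \<open>v\<close>; its kernel is exactly
  \<open>H\<close> when this value is nonzero. This makes every fibre of the kernel map as large as
  the set of nonzero scalars.\<close>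

lemma bij_betw_functionals_with_kernel:
  assumes H: "H \<in> hyperplanes" and v: "v \<notin> H"
  shows "bij_betw (\<lambda>f. f v) {f \<in> functionals. {x. f x = 0} = H} (- {0})"
proof (rule bij_betw_imageI)
  have span_H: "span H = H"
    using H by (simp add: hyperplanes_def span_eq_iff)
  show "inj_on (\<lambda>f. f v) {f \<in> functionals. {x. f x = 0} = H}"
  proof (rule inj_onI)
    fix f g
    assume "f \<in> {f \<in> functionals. {x. f x = 0} = H}" "g \<in> {f \<in> functionals. {x. f x = 0} = H}"
      and "f v = g v"
    then show "f = g"
      by (intro functional_eqI[OF _ _ span_insert_hyperplane[OF H v]]) auto
  qed
  have "c \<in> (\<lambda>f. f v) ` {f \<in> functionals. {x. f x = 0} = H}" if c: "c \<noteq> 0" for c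
  proof -
    obtain B where B: "B \<subseteq> H" "independent B" "H \<subseteq> span B"
      by (rule basis_exists)
    have span_B: "span B = H"
      using B span_H span_mono by blast
    then have "independent (insert v B)"
      using B v by (simp add: independent_insert)
    \<comment> \<open>The preimage of \<open>c\<close> is the functional that vanishes on a basis of
      \<open>H\<close> and takes the value \<open>c\<close> at \<open>v\<close>.\<close>
    then obtain f where f: "f \<in> functionals"
      "\<And>b. b \<in> insert v B \<Longrightarrow> f b = (if b = v then c else 0)"
      using functional_on_basis[of "insert v B" "\<lambda>b. if b = v then c else 0"] by blast
    interpret Vector_Spaces.linear scale "(*)" f
      using f(1) by (simp add: functionals_def)
    have f_H: "f x = 0" if "x \<in> H" for x
      using that B v f(2) span_B eq_0_on_span[of B x] by force
    have "x \<in> H" if "f x = 0" for x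
    proof -
      \<comment> \<open>Modulo \<open>H\<close>, \<open>x\<close> is \<open>k\<close> times
        \<open>v\<close>, so \<open>f x\<close> is \<open>k * c\<close>; as \<open>c\<close> is
        nonzero, \<open>f x = 0\<close> forces \<open>k = 0\<close>.\<close>
      obtain k where k: "x - k *s v \<in> H"
        using span_insert_hyperplane[OF H v] by (metis UNIV_I span_breakdown_eq span_H)
      then have "f x = k * c"
        using f_H[OF k] f(2)[of v] by (simp add: diff scale)
      with that c k show ?thesis
        by simp
    qed
    with f_H have "{x. f x = 0} = H"
      by blast
    moreover have "f v = c"
      using f(2) by simp
    ultimately show ?thesis
      using f(1) by blast
  qed
  then show "(\<lambda>f. f v) ` {f \<in> functionals. {x. f x = 0} = H} = - {0}"
    using v by auto
qed

text \<open>The kernel map partitions the nonzero functionals into one fibre per hyperplane, all of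
  the same size. The product form of the count avoids a division.\<close>

lemma
  assumes fin: "finite (UNIV :: 'a set)"
  shows finite_hyperplanes: "finite hyperplanes"
    and card_hyperplanes: "card hyperplanes * (card (UNIV :: 'a set) - 1) = card (UNIV :: 'a set) ^ dimension - 1"
proof -
  define \<F> where "\<F> H = {f \<in> functionals. {x. f x = 0} = H}" for H
  have card_\<F>: "card (\<F> H) = card (UNIV :: 'a set) - 1" if H: "H \<in> hyperplanes" for H
  proof -
    have "H \<noteq> UNIV"
      using H by (auto simp: hyperplanes_def dimension_def)
    then obtain v where "v \<notin> H"
      by blast
    from bij_betw_same_card[OF bij_betw_functionals_with_kernel[OF H this]] show ?thesis
      using fin by (simp add: \<F>_def Compl_eq_Diff_UNIV card_Diff_subset)
  qed
  have "card (UNIV :: 'a set) \<ge> 2"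
    using card_mono[OF fin, of "{0, 1}"] by simp
  then have \<F>_nonempty: "\<F> H \<noteq> {}" if "H \<in> hyperplanes" for H
    using card_\<F>[OF that] by auto
  have Un: "(\<Union>H\<in>hyperplanes. \<F> H) = functionals - {\<lambda>_. 0}"
  proof (intro equalityI subsetI)
    fix f assume "f \<in> (\<Union>H\<in>hyperplanes. \<F> H)"
    then show "f \<in> functionals - {\<lambda>_. 0}"
      by (auto simp: \<F>_def hyperplanes_def dimension_def)
  next
    fix f assume "f \<in> functionals - {\<lambda>_. 0}"
    then show "f \<in> (\<Union>H\<in>hyperplanes. \<F> H)"
      using kernel_in_hyperplanes[of f] by (auto simp: \<F>_def)
  qed
  \<comment> \<open>Nonempty fibres make every hyperplane a kernel, so finiteness passes from
    functionals to hyperplanes.\<close>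
  have "H \<in> (\<lambda>f. {x. f x = 0}) ` functionals" if "H \<in> hyperplanes" for H
    using \<F>_nonempty[OF that] by (auto simp: \<F>_def)
  then show fin_H: "finite hyperplanes"
    using finite_functionals[OF fin] by (meson finite_imageI finite_subset subsetI)
  have "card (\<Union>H\<in>hyperplanes. \<F> H) = (\<Sum>H\<in>hyperplanes. card (\<F> H))"
    using finite_functionals[OF fin] fin_H by (intro card_UN_disjoint) (auto simp: \<F>_def)
  also have "\<dots> = card hyperplanes * (card (UNIV :: 'a set) - 1)"
    by (simp add: card_\<F>)
  finally show "card hyperplanes * (card (UNIV :: 'a set) - 1) = card (UNIV :: 'a set) ^ dimension - 1"
    using finite_functionals[OF fin] zero_in_functionals
    by (simp add: Un card_functionals[OF fin])
qed

text \<open>The span of the union is the sum of the two subspaces, whose dimension is given by the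
  dimension formula; it is the whole space iff this dimension is full.\<close>

lemma span_Un_eq_UNIV_iff:
  assumes "subspace A" "subspace B"
  shows "span (A \<union> B) = UNIV \<longleftrightarrow> dim A + dim B = dimension + dim (A \<inter> B)"
proof -
  have "span A = A" "span B = B"
    using assms by (simp_all add: span_eq_iff)
  then have "span (A \<union> B) = {x + y | x y. x \<in> A \<and> y \<in> B}"
    using span_Un[of A B] by (simp only:)
  then have "dim (A \<union> B) + dim (A \<inter> B) = dim A + dim B"
    using dim_sums_Int[OF assms] by (metis dim_span)
  then show ?thesis
    using dim_eq_full[of "A \<union> B"] by auto
qed

lemma dim_eq_0_iff_subspace:
  assumes "subspace A"
  shows "dim A = 0 \<longleftrightarrow> A = {0}"
  using subspace_0[OF assms] by auto

lemma dim_eq_dimension_iff_subspace: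
  assumes "subspace A"
  shows "dim A = dimension \<longleftrightarrow> A = UNIV"
  using assms by (simp add: dim_eq_full span_eq_iff[THEN iffD2])

text \<open>Having equal dimension, distinct hyperplanes do not contain one another; a vector of
  \<open>B\<close> outside \<open>A\<close> already completes \<open>A\<close> to a spanning
  set.\<close>

lemma span_Un_hyperplanes:
  assumes A: "A \<in> hyperplanes" and B: "B \<in> hyperplanes" and "A \<noteq> B"
  shows "span (A \<union> B) = UNIV"
proof -
  have "\<exists>v\<in>B. v \<notin> A"
    using subspace_dim_equal[of B A] A B \<open>A \<noteq> B\<close> by (auto simp: hyperplanes_def)
  then obtain v where v: "v \<in> B" "v \<notin> A"
    by blast
  then have "span (insert v A) \<subseteq> span (A \<union> B)"
    by (intro span_mono) auto
  with span_insert_hyperplane[OF A v(2)] show ?thesis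
    by auto
qed

end

section \<open>Abelian Lie algebras and the comaximal graph\<close>

context lie_algebra
begin

lemma abelian_lie_subalgebra_iff: "abelian \<Longrightarrow> lie_subalgebra A \<longleftrightarrow> subspace A"
  by (auto simp: abelian_def lie_subalgebra_def subspace_0)

text \<open>Both sides are hulls, and the two predicates coincide.\<close>

lemma abelian_lie_generated: "abelian \<Longrightarrow> lie_generated S = span S"
  using ext[of lie_subalgebra subspace, OF abelian_lie_subalgebra_iff]
  by (simp add: lie_generated_def span_def)

lemma verts_comaximal_graph:
  "verts comaximal_graph = {A. lie_subalgebra A \<and> A \<noteq> {0} \<and> A \<noteq> UNIV}"
  by (simp add: comaximal_graph_def Let_def)

lemma dominates_comaximal_graph_iff:
  "A \<rightarrow>\<^bsub>comaximal_graph\<^esub> B \<longleftrightarrow>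
    A \<in> verts comaximal_graph \<and> B \<in> verts comaximal_graph \<and> A \<noteq> B \<and>
    lie_generated (A \<union> B) = UNIV"
  by (simp add: comaximal_graph_def Let_def)

end

lemma complete_digraph_induce_subgraphI:
  assumes "sym_digraph G" "loopfree_digraph G" "nomulti_digraph G"
    and S: "finite S"
    and dom: "\<And>u v. u \<in> S \<Longrightarrow> v \<in> S \<Longrightarrow> u \<noteq> v \<Longrightarrow> u \<rightarrow>\<^bsub>G\<^esub> v"
  shows "K\<^bsub>card S\<^esub> (G \<restriction> S)"
proof -
  interpret sym_digraph G by fact
  interpret loopfree_digraph G by fact
  interpret nomulti_digraph G by fact
  have ends: "arcs_ends (G \<restriction> S) = {(u, v). u \<in> S \<and> v \<in> S \<and> u \<noteq> v}"
    using dom no_loops by (fastforce simp: arcs_ends_conv)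
  have inj: "inj_on (arc_to_ends G) (arcs (G \<restriction> S))"
    by (auto intro!: inj_onI no_multi_arcs)
  \<comment> \<open>\<open>G\<close> may be infinite; without multiple arcs the induced arcs embed
    into the finite set of pairs, as a finite graph requires.\<close>
  have "arc_to_ends G ` arcs (G \<restriction> S) \<subseteq> S \<times> S"
    by (auto simp: arc_to_ends_def)
  then have "finite (arcs (G \<restriction> S))"
    using inj S by (meson finite_SigmaI finite_imageD finite_subset)
  moreover have "sym (arcs_ends (G \<restriction> S))"
    unfolding ends by (auto intro: symI)
  ultimately have "graph (G \<restriction> S)"
    using S no_loops no_multi_arcs
    by unfold_locales (auto simp: arc_to_ends_def symmetric_def)
  then show ?thesis
    by (simp add: complete_digraph_def ends)
qed

theorem proposition4p2:
  fixes scale :: "'k::{field,finite} \<Rightarrow> 'v::ab_group_add \<Rightarrow> 'v"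
    and bracket :: "'v \<Rightarrow> 'v \<Rightarrow> 'v"
    and q :: nat
    and \<Gamma> :: "('v set, 'v set \<times> 'v set) pre_digraph"
    and \<L> \<P>\<^sub>2 \<P>\<^sub>3 :: "'v set set"
  assumes "card (UNIV :: 'k set) = q"
    and "lie_algebra scale bracket"
    and "lie_algebra.abelian bracket"
    and "vector_space.dim scale (UNIV :: 'v set) = 4"
    and "\<Gamma> = lie_algebra.comaximal_graph scale bracket"
    and "\<L> = lie_algebra.lie_subalgebras_of_dim scale bracket 1"
    and "\<P>\<^sub>2 = lie_algebra.lie_subalgebras_of_dim scale bracket 2"
    and "\<P>\<^sub>3 = lie_algebra.lie_subalgebras_of_dim scale bracket 3"
  shows "(verts \<Gamma> = \<L> \<union> \<P>\<^sub>2 \<union> \<P>\<^sub>3 \<and> \<L> \<inter> \<P>\<^sub>2 = {} \<and> \<L> \<inter> \<P>\<^sub>3 = {} \<and> \<P>\<^sub>2 \<inter> \<P>\<^sub>3 = {}) \<and>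
    ((\<forall>A\<in>\<P>\<^sub>3. \<forall>B\<in>\<P>\<^sub>3. A \<noteq> B \<longrightarrow> A \<rightarrow>\<^bsub>\<Gamma>\<^esub> B) \<and>
      K\<^bsub>q^3 + q^2 + q + 1\<^esub> (\<Gamma> \<restriction> \<P>\<^sub>3)) \<and>
    (\<forall>A\<in>\<P>\<^sub>2. \<forall>B\<in>\<P>\<^sub>2. A \<rightarrow>\<^bsub>\<Gamma>\<^esub> B \<longleftrightarrow> A \<inter> B = {0}) \<and>
    ((\<forall>A\<in>\<L>. \<forall>B\<in>\<L>. \<not> A \<rightarrow>\<^bsub>\<Gamma>\<^esub> B) \<and> independent_vertices \<Gamma> \<L>) \<and>
    (\<forall>A\<in>\<L>. \<forall>B\<in>\<P>\<^sub>2. \<not> A \<rightarrow>\<^bsub>\<Gamma>\<^esub> B) \<and>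
    (\<forall>A\<in>\<L>. \<forall>B\<in>\<P>\<^sub>3. A \<rightarrow>\<^bsub>\<Gamma>\<^esub> B \<longleftrightarrow> A \<inter> B = {0})"
proof -
  interpret lie_algebra scale bracket by fact
  have abelian: abelian by fact
  \<comment> \<open>Infinite sets have cardinality 0, so a basis of cardinality 4 is finite and the
    finite-dimensional theory applies.\<close>
  obtain Basis where Basis: "independent Basis" "span Basis = UNIV" "card Basis = 4"
    using basis_exists[of UNIV] assms(4) by (metis top.extremum_uniqueI)
  interpret finite_dimensional_vector_space scale Basis
    using Basis by unfold_locales (auto intro: card_ge_0_finite)
  have dimension: "dimension = 4"
    using Basis by (simp add: dimension_def)

  note subalgebra_iff = abelian_lie_subalgebra_iff[OF abelian]
  have \<L>: "\<L> = {A. subspace A \<and> dim A = 1}"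
    and \<P>\<^sub>2: "\<P>\<^sub>2 = {A. subspace A \<and> dim A = 2}"
    and \<P>\<^sub>3: "\<P>\<^sub>3 = {A. subspace A \<and> dim A = 3}"
    using assms by (simp_all add: lie_subalgebras_of_dim_def subalgebra_iff)
  note defs = \<L> \<P>\<^sub>2 \<P>\<^sub>3
  have \<P>\<^sub>3_hyperplanes: "\<P>\<^sub>3 = hyperplanes"
    by (auto simp: \<P>\<^sub>3 hyperplanes_def dimension)

  have verts: "verts \<Gamma> = \<L> \<union> \<P>\<^sub>2 \<union> \<P>\<^sub>3"
  proof -
    \<comment> \<open>Dimensions range from 0 to 4, and the two extremes belong only to the zero
      space and the whole space.\<close>
    have "A \<noteq> {0} \<and> A \<noteq> UNIV \<longleftrightarrow> dim A = 1 \<or> dim A = 2 \<or> dim A = 3" if "subspace A" for A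
      using dim_eq_0_iff_subspace[OF that] dim_eq_dimension_iff_subspace[OF that]
        dim_subset_UNIV[of A] dimension by linarith
    then show ?thesis
      by (auto simp: assms(5) verts_comaximal_graph subalgebra_iff defs)
  qed
  have adj: "A \<rightarrow>\<^bsub>\<Gamma>\<^esub> B \<longleftrightarrow> A \<noteq> B \<and> span (A \<union> B) = UNIV"
    if "A \<in> \<L> \<union> \<P>\<^sub>2 \<union> \<P>\<^sub>3" "B \<in> \<L> \<union> \<P>\<^sub>2 \<union> \<P>\<^sub>3" for A B
    using that verts abelian_lie_generated[OF abelian]
    by (simp add: assms(5) dominates_comaximal_graph_iff)
  have adj_dim: "A \<rightarrow>\<^bsub>\<Gamma>\<^esub> B \<longleftrightarrow> A \<noteq> B \<and> dim A + dim B = 4 + dim (A \<inter> B)"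
    if "A \<in> \<L> \<union> \<P>\<^sub>2 \<union> \<P>\<^sub>3" "B \<in> \<L> \<union> \<P>\<^sub>2 \<union> \<P>\<^sub>3" for A B
    using adj[OF that] that span_Un_eq_UNIV_iff[of A B] by (auto simp: defs dimension)
  have Int_0: "A \<inter> B = {0} \<longleftrightarrow> dim (A \<inter> B) = 0"
    if "A \<in> \<L> \<union> \<P>\<^sub>2 \<union> \<P>\<^sub>3" "B \<in> \<L> \<union> \<P>\<^sub>2 \<union> \<P>\<^sub>3" for A B
    using that dim_eq_0_iff_subspace[of "A \<inter> B"] by (auto simp: defs subspace_inter)

  have adj_\<P>\<^sub>3: "A \<rightarrow>\<^bsub>\<Gamma>\<^esub> B" if "A \<in> \<P>\<^sub>3" "B \<in> \<P>\<^sub>3" "A \<noteq> B" for A B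
    using that adj span_Un_hyperplanes by (simp add: \<P>\<^sub>3_hyperplanes)
  have card_\<P>\<^sub>3: "card \<P>\<^sub>3 = q^3 + q^2 + q + 1"
  proof -
    have "q \<ge> 2"
      using card_mono[of UNIV "{0, 1 :: 'k}"] assms(1) by simp
    \<comment> \<open>Writing \<open>q - 1\<close> as \<open>r\<close> removes truncated subtraction
      from the geometric sum identity, and \<open>r > 0\<close> permits the final
      cancellation.\<close>
    then obtain r where q: "q = Suc r" and "r > 0"
      by (cases q) auto
    have "card \<P>\<^sub>3 * r = q ^ 4 - 1"
      using card_hyperplanes assms(1) by (simp add: \<P>\<^sub>3_hyperplanes dimension q)
    also have "\<dots> = (q^3 + q^2 + q + 1) * r"
      by (simp add: q power4_eq_xxxx power3_eq_cube power2_eq_square algebra_simps)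
    finally show ?thesis
      using \<open>r > 0\<close> by (metis mult_right_cancel less_irrefl)
  qed
  have complete: "K\<^bsub>q^3 + q^2 + q + 1\<^esub> (\<Gamma> \<restriction> \<P>\<^sub>3)"
    unfolding card_\<P>\<^sub>3[symmetric]
  proof (rule complete_digraph_induce_subgraphI)
    show "sym_digraph \<Gamma>" "loopfree_digraph \<Gamma>" "nomulti_digraph \<Gamma>"
      by (simp_all add: assms(5) sym_digraph_comaximal_graph loopfree_digraph_comaximal_graph
          nomulti_digraph_comaximal_graph)
    show "finite \<P>\<^sub>3"
      by (simp add: \<P>\<^sub>3_hyperplanes finite_hyperplanes)
  qed (rule adj_\<P>\<^sub>3)

  \<comment> \<open>The dimensions add up to exactly 4, so the intersection must be zero; this also
    rules out \<open>A = B\<close>, whose intersection would have dimension 2.\<close>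
  have adj_\<P>\<^sub>2: "A \<rightarrow>\<^bsub>\<Gamma>\<^esub> B \<longleftrightarrow> A \<inter> B = {0}" if "A \<in> \<P>\<^sub>2" "B \<in> \<P>\<^sub>2" for A B
    using that adj_dim[of A B] Int_0[of A B] by (auto simp: \<P>\<^sub>2)
  \<comment> \<open>Here the dimensions add up to at most 3, too little to span.\<close>
  have adj_\<L>: "\<not> A \<rightarrow>\<^bsub>\<Gamma>\<^esub> B" if "A \<in> \<L>" "B \<in> \<L> \<union> \<P>\<^sub>2" for A B
    using that adj_dim[of A B] by (auto simp: \<L> \<P>\<^sub>2)
  have adj_\<L>_\<P>\<^sub>3: "A \<rightarrow>\<^bsub>\<Gamma>\<^esub> B \<longleftrightarrow> A \<inter> B = {0}" if "A \<in> \<L>" "B \<in> \<P>\<^sub>3" for A B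
    using that adj_dim[of A B] Int_0[of A B] by (auto simp: \<L> \<P>\<^sub>3)
  have "\<L> \<inter> \<P>\<^sub>2 = {}" "\<L> \<inter> \<P>\<^sub>3 = {}" "\<P>\<^sub>2 \<inter> \<P>\<^sub>3 = {}"
    by (auto simp: defs)
  with verts adj_\<P>\<^sub>3 complete adj_\<P>\<^sub>2 adj_\<L> adj_\<L>_\<P>\<^sub>3 show ?thesis
    by (auto simp: independent_vertices_def)
qed

end
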